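(* Let $A$ be an arbitrary subset of $\mathbb{R}$ and let $R$ be a positive real number. For every collection $\mathcal{F}$ of closed intervals $[x-r,x+r]$ with $x\in A$ and $0<r\leqslant R$, such that each point of $A$ is the center of some interval of $\mathcal{F}$, there are two subcollections $\mathcal{F}_1$ and $\mathcal{F}_2$ of $\mathcal{F}$, each consisting of pairwise disjoint intervals, such that $$A\subset\bigcup_{i=1,2}\ \bigcup_{I\in\mathcal{F}_i}I.$$ *)

theory Defs imports Complex_Main begin

end

theory Submission imports Defs begin

text \<open>
  Fix a radius \<open>r x\<close> for every \<open>x \<in> A\<close>. In stage \<open>n\<close>, among the points of radius greater than
  \<open>1 / (n + 1)\<close> not yet covered by the open intervals chosen earlier, choose one point in each
  cell of length \<open>1 / (n + 1)\<close>. The open intervals chosen cover \<open>A\<close>, and the centres chosen after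
  a point \<open>p\<close> is covered keep a fixed distance from \<open>p\<close> while their radii tend to \<open>0\<close>; so every
  \<open>p \<in> A\<close> lies in finitely many of the chosen closed intervals. By Zorn's lemma such a point-finite
  cover contains an irredundant one. In an irredundant family each interval meets at most one
  interval that starts further to the right, so its intersection graph is a forest and can be
  coloured with two colours.
\<close>

section \<open>Two-colouring the graph of an acyclic partial function\<close>

lemma relpow_length_unique:
  assumes "single_valued r" "acyclic r" "(x, z) \<in> r ^^ a" "(x, z) \<in> r ^^ b"
  shows "a = b"
proof -
  have *: False if xz: "(x, z) \<in> r ^^ a" "(x, z) \<in> r ^^ b" and "a < b" for a b
  proof -
    obtain k where k: "b = a + k" "k > 0"
      using \<open>a < b\<close> less_imp_add_positive by blast
    then obtain w where w: "(x, w) \<in> r ^^ a" "(w, z) \<in> r ^^ k"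
      using xz(2) by (auto simp: relpow_add)
    \<comment> \<open>The longer walk must pass through \<open>z\<close> after \<open>a\<close>
      steps, so its last \<open>k\<close> steps form a cycle.\<close>
    then have "w = z"
      using single_valued_relpow[OF assms(1)] xz(1) by (meson single_valuedD)
    then have "(z, z) \<in> r\<^sup>+"
      using w k by (auto simp: trancl_power)
    then show False
      using assms(2) by (auto simp: acyclic_def)
  qed
  show ?thesis
    using *[of a b] *[of b a] assms(3,4) by (meson linorder_neqE_nat)
qed

text \<open>With \<open>m \<le> m'\<close>, the walk from \<open>x\<close> to \<open>z'\<close>
  passes through \<open>z\<close>. Both walks to \<open>z'\<close> therefore prolong those to
  \<open>z\<close> by the same \<open>k\<close> steps, and the total length changes by
  \<open>2 * k\<close>.\<close>

lemma relpow_meet_parity: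
  assumes r: "single_valued r" "acyclic r"
    and "(x, z) \<in> r ^^ m" "(y, z) \<in> r ^^ n" "(x, z') \<in> r ^^ m'" "(y, z') \<in> r ^^ n'"
  shows "even (m + n) \<longleftrightarrow> even (m' + n')"
proof -
  have *: "even (m + n) \<longleftrightarrow> even (m' + n')"
    if meet: "(x, z) \<in> r ^^ m" "(y, z) \<in> r ^^ n" "(x, z') \<in> r ^^ m'" "(y, z') \<in> r ^^ n'" and "m \<le> m'"
    for m n m' n' z z'
  proof -
    obtain k where k: "m' = m + k"
      using \<open>m \<le> m'\<close> le_Suc_ex by blast
    then obtain w where w: "(x, w) \<in> r ^^ m" "(w, z') \<in> r ^^ k"
      using meet(3) by (auto simp: relpow_add)
    then have "w = z"
      using single_valued_relpow[OF r(1)] meet(1) by (meson single_valuedD)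
    then have "(y, z') \<in> r ^^ (n + k)"
      using w meet(2) by (auto simp: relpow_add)
    then have "n' = n + k"
      using relpow_length_unique[OF r] meet(4) by blast
    then show ?thesis
      using k by auto
  qed
  show ?thesis
    using *[OF assms(3-6)] *[OF assms(5,6,3,4)] by (meson nat_le_linear)
qed

text \<open>The colour of a vertex is the parity of a route to a representative of its component,
  forward to a common descendant and then backward. \<open>relpow_meet_parity\<close> makes it
  independent of the route.\<close>

lemma single_valued_acyclic_two_colouring:
  fixes r :: "('a \<times> 'a) set"
  assumes r: "single_valued r" "acyclic r"
  obtains c :: "'a \<Rightarrow> bool" where "\<And>x y. (x, y) \<in> r \<Longrightarrow> c x \<noteq> c y"
proof
  define joined where "joined x y \<longleftrightarrow> (\<exists>m n z. (x, z) \<in> r ^^ m \<and> (y, z) \<in> r ^^ n)" for x y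
  \<comment> \<open>Equal predicates \<open>joined x\<close> and \<open>joined x'\<close> give the
    same choice, so adjacent vertices share a representative.\<close>
  define rep where "rep x = (SOME y. joined x y)" for x
  define c where
    "c x \<longleftrightarrow> (\<exists>m n z. (x, z) \<in> r ^^ m \<and> (rep x, z) \<in> r ^^ n \<and> even (m + n))" for x
  fix x x' assume xx': "(x, x') \<in> r"
  \<comment> \<open>Crossing one edge flips the parity: either the walk from \<open>x\<close> starts
    with that edge and loses it, or \<open>x\<close> is itself the meeting point and the walk from
    \<open>y\<close> gains the edge.\<close>
  have step: "\<exists>m' n' z'. (x', z') \<in> r ^^ m' \<and> (y, z') \<in> r ^^ n' \<and> (even (m' + n') \<longleftrightarrow> odd (m + n))"
    if yz: "(x, z) \<in> r ^^ m" "(y, z) \<in> r ^^ n" for y m n z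
  proof (cases m)
    case 0
    then have "(y, x') \<in> r ^^ Suc n"
      using yz xx' by auto
    then show ?thesis
      using 0 by (intro exI[of _ 0] exI[of _ "Suc n"] exI[of _ x']) auto
  next
    case (Suc k)
    obtain w where w: "(x, w) \<in> r" "(w, z) \<in> r ^^ k"
      using yz(1) relpow_Suc_D2 unfolding Suc by metis
    then have "w = x'"
      using r(1) xx' by (meson single_valuedD)
    then show ?thesis
      using w yz(2) Suc by (intro exI[of _ k] exI[of _ n] exI[of _ z]) auto
  qed
  have "joined x y \<longleftrightarrow> joined x' y" for y
    unfolding joined_def using step relpow_Suc_I2[OF xx'] by meson
  then have rep_eq: "rep x' = rep x"
    by (simp add: rep_def)
  have "joined x x"
    unfolding joined_def by (meson relpow_0_I)
  then have "joined x (rep x)"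
    unfolding rep_def by (rule someI)
  then obtain m n z where mn: "(x, z) \<in> r ^^ m" "(rep x, z) \<in> r ^^ n"
    by (auto simp: joined_def)
  obtain m' n' z' where mn': "(x', z') \<in> r ^^ m'" "(rep x, z') \<in> r ^^ n'"
      "even (m' + n') \<longleftrightarrow> odd (m + n)"
    using step[OF mn] by blast
  have "c u \<longleftrightarrow> even (m + n)" if "(u, z) \<in> r ^^ m" "(rep u, z) \<in> r ^^ n" for u m n z
    unfolding c_def using that relpow_meet_parity[OF r that] by blast
  then show "c x \<noteq> c x'"
    using mn mn' rep_eq by auto
qed

section \<open>Irredundant covers and their colouring\<close>

lemma point_finite_cover_irredundant:
  assumes cover: "A \<subseteq> \<Union>F" and fin: "\<And>x. x \<in> A \<Longrightarrow> finite {I \<in> F. x \<in> I}"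
  obtains C where "C \<subseteq> F" "A \<subseteq> \<Union>C" "\<And>I. I \<in> C \<Longrightarrow> \<not> A \<subseteq> \<Union>(C - {I})"
proof -
  \<comment> \<open>Zorn is applied to the removable subfamilies: a maximal one leaves an
    irredundant cover.\<close>
  define \<D> where "\<D> = {D. D \<subseteq> F \<and> A \<subseteq> \<Union>(F - D)}"
  have "\<exists>U\<in>\<D>. \<forall>D\<in>\<C>. D \<subseteq> U" if "subset.chain \<D> \<C>" for \<C>
  proof (cases "\<C> = {}")
    case True
    then show ?thesis
      using cover by (intro bexI[of _ "{}"]) (auto simp: \<D>_def)
  next
    case False
    have "x \<in> \<Union>(F - \<Union>\<C>)" if "x \<in> A" for x
    proof (rule ccontr)
      assume "x \<notin> \<Union>(F - \<Union>\<C>)"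
      then have "{I \<in> F. x \<in> I} \<subseteq> \<Union>\<C>"
        by auto
      \<comment> \<open>The finitely many members containing \<open>x\<close> would all be removed
        by a single \<open>D\<close> of the chain, although \<open>F - D\<close> still covers
        \<open>x\<close>.\<close>
      then obtain D where "D \<in> \<C>" "{I \<in> F. x \<in> I} \<subseteq> D"
        using finite_subset_Union_chain[OF fin[OF \<open>x \<in> A\<close>] _ False \<open>subset.chain \<D> \<C>\<close>] by blast
      moreover have "D \<in> \<D>"
        using \<open>D \<in> \<C>\<close> \<open>subset.chain \<D> \<C>\<close> by (auto simp: subset.chain_def)
      ultimately show False
        using \<open>x \<in> A\<close> by (auto simp: \<D>_def)
    qed
    moreover have "\<Union>\<C> \<subseteq> F"
      using \<open>subset.chain \<D> \<C>\<close> by (auto simp: subset.chain_def \<D>_def)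
    ultimately show ?thesis
      by (intro bexI[of _ "\<Union>\<C>"]) (auto simp: \<D>_def)
  qed
  then have "\<exists>D\<in>\<D>. \<forall>X\<in>\<D>. D \<subseteq> X \<longrightarrow> X = D"
    by (rule subset_Zorn)
  then obtain D where D: "D \<in> \<D>" "\<And>X. X \<in> \<D> \<Longrightarrow> D \<subseteq> X \<Longrightarrow> X = D"
    by blast
  show thesis
  proof
    show "F - D \<subseteq> F" "A \<subseteq> \<Union>(F - D)"
      using D(1) by (auto simp: \<D>_def)
    show "\<not> A \<subseteq> \<Union>(F - D - {I})" if "I \<in> F - D" for I
    proof
      assume "A \<subseteq> \<Union>(F - D - {I})"
      moreover have "F - D - {I} = F - insert I D"
        by blast
      ultimately have "insert I D \<in> \<D>"
        using D(1) that by (simp add: \<D>_def)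
      then show False
        using D(2)[of "insert I D"] that by blast
    qed
  qed
qed

text \<open>Each overlap is oriented towards the larger left endpoint, which is \<open>Inf\<close>.
  Every interval owns a point of \<open>A\<close> that lies in no other member, so none is contained
  in the union of two others; this leaves at most one outgoing edge.\<close>

lemma irredundant_intervals_two_colouring:
  fixes C :: "real set set"
  assumes iv: "\<And>I. I \<in> C \<Longrightarrow> \<exists>a b. a \<le> b \<and> I = {a..b}"
    and cover: "A \<subseteq> \<Union>C" and irr: "\<And>I. I \<in> C \<Longrightarrow> \<not> A \<subseteq> \<Union>(C - {I})"
  obtains C1 C2 where "C = C1 \<union> C2" "pairwise disjnt C1" "pairwise disjnt C2"
proof -
  define r where "r = {(I, J). I \<in> C \<and> J \<in> C \<and> Inf I < Inf J \<and> \<not> disjnt I J}"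
  have own_point: "\<exists>x\<in>I. \<forall>J\<in>C. x \<in> J \<longrightarrow> J = I" if I: "I \<in> C" for I
  proof -
    obtain x where "x \<in> A" "x \<notin> \<Union>(C - {I})"
      using irr[OF I] by blast
    then show ?thesis
      using cover by blast
  qed
  have no_cover: "\<not> I \<subseteq> J \<union> K" if "I \<in> C" "J \<in> C" "K \<in> C" "J \<noteq> I" "K \<noteq> I" for I J K
    using own_point[OF that(1)] that by blast
  have inf_inj: "I = J" if "I \<in> C" "J \<in> C" "Inf I = Inf J" for I J
  proof (rule ccontr)
    assume "I \<noteq> J"
    obtain a b where I: "a \<le> b" "I = {a..b}" using iv \<open>I \<in> C\<close> by blast
    obtain c d where J: "c \<le> d" "J = {c..d}" using iv \<open>J \<in> C\<close> by blast
    have "a = c" using I J that(3) by simp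
    \<comment> \<open>Nested members are excluded, so left endpoints are distinct and every overlap
      gets an orientation.\<close>
    then have "I \<subseteq> J \<or> J \<subseteq> I" using I J by auto
    then show False
      using no_cover[of I J J] no_cover[of J I I] that \<open>I \<noteq> J\<close> by auto
  qed
  have *: False
    if "(I, J) \<in> r" "(I, K) \<in> r" "Inf J < Inf K" for I J K
  proof -
    have mem: "I \<in> C" "J \<in> C" "K \<in> C" and less: "Inf I < Inf J" "Inf I < Inf K"
      using that by (auto simp: r_def)
    obtain a b where I: "a \<le> b" "I = {a..b}" using iv mem by blast
    obtain c d where J: "c \<le> d" "J = {c..d}" using iv mem by blast
    obtain e f where K: "e \<le> f" "K = {e..f}" using iv mem by blast
    have ord: "a < c" "c < e"
      using less that(3) I J K by auto
    have "e \<le> b"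
      using that(2) I K by (auto simp: r_def disjnt_iff)
    \<comment> \<open>If \<open>d \<le> f\<close>, then \<open>J\<close> lies in
      \<open>I \<union> K\<close>, which has no gap because \<open>e \<le> b\<close>; otherwise
      \<open>K\<close> lies in \<open>J\<close>.\<close>
    then have "J \<subseteq> I \<union> K \<or> K \<subseteq> I \<union> J"
      using ord I J K by auto
    moreover have "I \<noteq> J" "I \<noteq> K" "J \<noteq> K"
      using less that(3) by auto
    ultimately show False
      using no_cover mem by metis
  qed
  have "single_valued r"
  proof (rule single_valuedI)
    fix I J K assume "(I, J) \<in> r" "(I, K) \<in> r"
    moreover have "J \<in> C" "K \<in> C" using calculation by (auto simp: r_def)
    ultimately show "J = K"
      using *[of I J K] *[of I K J] inf_inj by (meson linorder_neqE)
  qed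
  moreover have "acyclic r"
    by (rule acyclicI_order[where f = "\<lambda>I. - Inf I"]) (auto simp: r_def)
  ultimately obtain c :: "real set \<Rightarrow> bool" where c: "\<And>I J. (I, J) \<in> r \<Longrightarrow> c I \<noteq> c J"
    by (rule single_valued_acyclic_two_colouring) blast
  have "disjnt I J" if "I \<in> C" "J \<in> C" "I \<noteq> J" "c I = c J" for I J
  proof (rule ccontr)
    assume "\<not> disjnt I J"
    moreover have "Inf I < Inf J \<or> Inf J < Inf I"
      using inf_inj that by (meson linorder_neqE)
    ultimately have "(I, J) \<in> r \<or> (J, I) \<in> r"
      using that by (auto simp: r_def disjnt_sym)
    then show False
      using c that(4) by metis
  qed
  then have "pairwise disjnt {I \<in> C. c I}" "pairwise disjnt {I \<in> C. \<not> c I}"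
    by (auto simp: pairwise_def)
  then show thesis
    by (intro that[of "{I \<in> C. c I}" "{I \<in> C. \<not> c I}"]) auto
qed

section \<open>Point-finite covers by centred intervals\<close>

definition net :: "real \<Rightarrow> real set \<Rightarrow> real set"
  where "net d B = (\<lambda>x. SOME y. y \<in> B \<and> \<lfloor>y / d\<rfloor> = \<lfloor>x / d\<rfloor>) ` B"

lemma net_subset: "net d B \<subseteq> B"
proof -
  have "(SOME y. y \<in> B \<and> \<lfloor>y / d\<rfloor> = \<lfloor>x / d\<rfloor>) \<in> B" if "x \<in> B" for x
    using someI[of "\<lambda>y. y \<in> B \<and> \<lfloor>y / d\<rfloor> = \<lfloor>x / d\<rfloor>" x] that by simp
  then show ?thesis
    by (auto simp: net_def)
qed

lemma net_dense:
  assumes "d > 0" "x \<in> B"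
  obtains y where "y \<in> net d B" "\<bar>x - y\<bar> < d"
proof -
  define y where "y = (SOME y. y \<in> B \<and> \<lfloor>y / d\<rfloor> = \<lfloor>x / d\<rfloor>)"
  have "y \<in> net d B"
    unfolding net_def y_def using assms by blast
  moreover have "\<lfloor>y / d\<rfloor> = \<lfloor>x / d\<rfloor>"
    unfolding y_def using someI[of "\<lambda>y. y \<in> B \<and> \<lfloor>y / d\<rfloor> = \<lfloor>x / d\<rfloor>" x] assms by simp
  then have "\<bar>x / d - y / d\<bar> < 1"
    by linarith
  then have "\<bar>x - y\<bar> < d"
    using assms by (simp add: diff_divide_distrib[symmetric] abs_divide)
  ultimately show thesis
    using that by blast
qed

text \<open>The choice depends on \<open>x\<close> only through its cell, so each cell contributes
  at most one point.\<close>

lemma inj_on_net: "inj_on (\<lambda>y. \<lfloor>y / d\<rfloor>) (net d B)"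
proof -
  have "\<lfloor>(SOME y. y \<in> B \<and> \<lfloor>y / d\<rfloor> = \<lfloor>x / d\<rfloor>) / d\<rfloor> = \<lfloor>x / d\<rfloor>" if "x \<in> B" for x
    using someI[of "\<lambda>y. y \<in> B \<and> \<lfloor>y / d\<rfloor> = \<lfloor>x / d\<rfloor>" x] that by simp
  then show ?thesis
    by (auto simp: inj_on_def net_def)
qed

lemma net_locally_finite:
  assumes "d > 0"
  shows "finite {y \<in> net d B. \<bar>y - p\<bar> \<le> s}"
proof (rule inj_on_finite)
  show "inj_on (\<lambda>y. \<lfloor>y / d\<rfloor>) {y \<in> net d B. \<bar>y - p\<bar> \<le> s}"
    using inj_on_net by (rule inj_on_subset) auto
  show "(\<lambda>y. \<lfloor>y / d\<rfloor>) ` {y \<in> net d B. \<bar>y - p\<bar> \<le> s} \<subseteq> {\<lfloor>(p - s) / d\<rfloor>..\<lfloor>(p + s) / d\<rfloor>}"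
    using assms by (auto intro!: floor_mono divide_right_mono)
qed simp

text \<open>\<open>1 / Suc n\<close> is both the mesh and the lower bound on the radii: a chosen
  point within the mesh of \<open>x\<close> has a radius exceeding the mesh, so its open interval
  contains \<open>x\<close>.\<close>

primrec centres :: "real set \<Rightarrow> (real \<Rightarrow> real) \<Rightarrow> nat \<Rightarrow> real set"
  where
    "centres A r 0 = {}"
  | "centres A r (Suc n) = centres A r n \<union>
       net (1 / Suc n) {x \<in> A. 1 / Suc n < r x \<and> (\<forall>y\<in>centres A r n. \<not> \<bar>x - y\<bar> < r y)}"

lemma centres_subset: "centres A r n \<subseteq> A"
proof (induction n)
  case (Suc n)
  show ?case
    unfolding centres.simps
    by (intro Un_least Suc.IH order_trans[OF net_subset]) (rule Collect_restrict)
qed simp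

lemma centres_mono: "m \<le> n \<Longrightarrow> centres A r m \<subseteq> centres A r n"
  by (rule lift_Suc_mono_le[where f = "centres A r"]) simp_all

lemma centres_cover:
  assumes "x \<in> A" "1 / Suc n < r x"
  shows "\<exists>y\<in>centres A r (Suc n). \<bar>x - y\<bar> < r y"
proof (cases "\<exists>y\<in>centres A r n. \<bar>x - y\<bar> < r y")
  case False
  let ?B = "{x \<in> A. 1 / Suc n < r x \<and> (\<forall>y\<in>centres A r n. \<not> \<bar>x - y\<bar> < r y)}"
  have "x \<in> ?B"
    using False assms by blast
  then obtain y where y: "y \<in> net (1 / Suc n) ?B" "\<bar>x - y\<bar> < 1 / Suc n"
    using net_dense[of "1 / Suc n" x ?B] by auto
  then have "1 / Suc n < r y"
    using net_subset by blast
  then show ?thesis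
    using y by (intro bexI[of _ y]) auto
qed auto

text \<open>The point \<open>z\<close> enters after stage \<open>m\<close>, and on entry it avoids
  the open intervals of all earlier stages.\<close>

lemma centres_later:
  assumes "z \<in> centres A r n" "z \<notin> centres A r m"
  shows "\<forall>y\<in>centres A r m. \<not> \<bar>z - y\<bar> < r y"
  using assms(1)
proof (induction n)
  case (Suc n)
  show ?case
  proof (cases "z \<in> centres A r n")
    case False
    then have "\<forall>y\<in>centres A r n. \<not> \<bar>z - y\<bar> < r y"
      using Suc.prems net_subset[of "1 / Suc n"] by fastforce
    moreover have "m \<le> n"
      using Suc.prems assms(2) centres_mono[of "Suc n" m A r] by (meson not_less_eq_eq subsetD)
    ultimately show ?thesis
      using centres_mono[of m n A r] by blast
  qed (rule Suc.IH)
qed simp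

lemma centres_locally_finite: "finite {y \<in> centres A r n. \<bar>y - p\<bar> \<le> s}"
proof (induction n)
  case (Suc n)
  let ?N = "net (1 / Suc n) {x \<in> A. 1 / Suc n < r x \<and> (\<forall>y\<in>centres A r n. \<not> \<bar>x - y\<bar> < r y)}"
  have "{y \<in> centres A r (Suc n). \<bar>y - p\<bar> \<le> s} =
      {y \<in> centres A r n. \<bar>y - p\<bar> \<le> s} \<union> {y \<in> ?N. \<bar>y - p\<bar> \<le> s}"
    by auto
  then show ?case
    using Suc.IH net_locally_finite[of "1 / Suc n"] by simp
qed simp

lemma point_finite_centred_cover:
  fixes A :: "real set" and r :: "real \<Rightarrow> real"
  assumes r: "\<And>x. x \<in> A \<Longrightarrow> 0 < r x \<and> r x \<le> R"
  obtains S where "S \<subseteq> A" "\<And>p. p \<in> A \<Longrightarrow> \<exists>y\<in>S. \<bar>p - y\<bar> < r y"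
    "\<And>p. p \<in> A \<Longrightarrow> finite {z \<in> S. \<bar>p - z\<bar> \<le> r z}"
proof
  let ?S = "\<Union>n. centres A r n"
  show "?S \<subseteq> A"
    using centres_subset by blast
  have covered: "\<exists>n. \<exists>y\<in>centres A r n. \<bar>p - y\<bar> < r y" if p: "p \<in> A" for p
  proof -
    obtain n where "1 / Suc n < r p"
      using r[OF p] nat_approx_posE by blast
    then show ?thesis
      using centres_cover[OF p] by blast
  qed
  then show "\<exists>y\<in>?S. \<bar>p - y\<bar> < r y" if "p \<in> A" for p
    using that by blast
  show "finite {z \<in> ?S. \<bar>p - z\<bar> \<le> r z}" if p: "p \<in> A" for p
  proof -
    obtain n y where y: "y \<in> centres A r n" "\<bar>p - y\<bar> < r y"
      using covered[OF p] by blast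
    \<comment> \<open>This is the slack of \<open>p\<close> in the open interval about
      \<open>y\<close>; a centre outside that interval has distance at least \<open>e\<close> from
      \<open>p\<close>.\<close>
    define e where "e = r y - \<bar>p - y\<bar>"
    obtain k where k: "1 / Suc k < e"
      using y nat_approx_posE[of e] by (auto simp: e_def)
    \<comment> \<open>By stage \<open>m\<close> the centre \<open>y\<close> is present and all
      points of radius above \<open>1 / Suc k\<close> are covered. A later centre whose closed
      interval contains \<open>p\<close> would have such a radius, yet be uncovered.\<close>
    define m where "m = max n (Suc k)"
    have "z \<in> centres A r m" if z: "z \<in> ?S" "\<bar>p - z\<bar> \<le> r z" for z
    proof (rule ccontr)
      assume nz: "z \<notin> centres A r m"
      obtain l where "z \<in> centres A r l"
        using z by blast
      then have far: "\<forall>u\<in>centres A r m. \<not> \<bar>z - u\<bar> < r u"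
        using nz by (rule centres_later)
      have "y \<in> centres A r m"
        using y centres_mono[of n m A r] by (auto simp: m_def)
      then have "e \<le> \<bar>p - z\<bar>"
        using far by (force simp: e_def)
      then have "1 / Suc k < r z"
        using k z(2) by linarith
      moreover have "z \<in> A"
        using \<open>z \<in> centres A r l\<close> centres_subset by blast
      ultimately have "\<exists>u\<in>centres A r (Suc k). \<bar>z - u\<bar> < r u"
        by (intro centres_cover)
      then show False
        using far centres_mono[of "Suc k" m A r] by (auto simp: m_def simp del: centres.simps)
    qed
    \<comment> \<open>The bound on the radii confines the remaining centres to a bounded window,
      where stage \<open>m\<close> is finite.\<close>
    moreover have "\<bar>z - p\<bar> \<le> R" if "z \<in> ?S" "\<bar>p - z\<bar> \<le> r z" for z
      using that r \<open>?S \<subseteq> A\<close> by fastforce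
    ultimately have "{z \<in> ?S. \<bar>p - z\<bar> \<le> r z} \<subseteq> {z \<in> centres A r m. \<bar>z - p\<bar> \<le> R}"
      by blast
    then show ?thesis
      by (rule finite_subset) (rule centres_locally_finite)
  qed
qed

theorem theorem5:
  fixes A :: "real set" and R :: real and F :: "real set set"
  assumes "R > 0"
    and "\<forall>I\<in>F. \<exists>x\<in>A. \<exists>r. 0 < r \<and> r \<le> R \<and> I = {x - r..x + r}"
    and "\<forall>x\<in>A. \<exists>r. 0 < r \<and> r \<le> R \<and> {x - r..x + r} \<in> F"
  shows "\<exists>F1 F2. F1 \<subseteq> F \<and> F2 \<subseteq> F \<and> pairwise disjnt F1 \<and> pairwise disjnt F2 \<and>
           A \<subseteq> \<Union>F1 \<union> \<Union>F2"
proof -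
  obtain r where r: "\<And>x. x \<in> A \<Longrightarrow> 0 < r x \<and> r x \<le> R \<and> {x - r x..x + r x} \<in> F"
    using assms(3) by metis
  obtain S where S: "S \<subseteq> A" "\<And>p. p \<in> A \<Longrightarrow> \<exists>y\<in>S. \<bar>p - y\<bar> < r y"
      "\<And>p. p \<in> A \<Longrightarrow> finite {z \<in> S. \<bar>p - z\<bar> \<le> r z}"
    using point_finite_centred_cover[of A r R] r by blast
  define I where "I x = {x - r x..x + r x}" for x
  have mem_I: "p \<in> I z \<longleftrightarrow> \<bar>p - z\<bar> \<le> r z" for p z
    by (auto simp: I_def)
  have "I ` S \<subseteq> F"
    using r S(1) by (auto simp: I_def)
  \<comment> \<open>The open intervals already cover \<open>A\<close>; the closed ones do so a
    fortiori and are still point-finite on \<open>A\<close>.\<close>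
  have "A \<subseteq> \<Union>(I ` S)"
    using S(2) mem_I by (fastforce intro: less_imp_le)
  moreover have "finite {J \<in> I ` S. p \<in> J}" if "p \<in> A" for p
  proof -
    have "{J \<in> I ` S. p \<in> J} = I ` {z \<in> S. \<bar>p - z\<bar> \<le> r z}"
      using mem_I by auto
    then show ?thesis
      using S(3)[OF that] by simp
  qed
  ultimately obtain C where C: "C \<subseteq> I ` S" "A \<subseteq> \<Union>C" "\<And>J. J \<in> C \<Longrightarrow> \<not> A \<subseteq> \<Union>(C - {J})"
    by (rule point_finite_cover_irredundant) blast+
  have "\<exists>a b. a \<le> b \<and> J = {a..b}" if J: "J \<in> C" for J
  proof -
    obtain x where "x \<in> A" "J = {x - r x..x + r x}"
      using J C(1) S(1) by (auto simp: I_def)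
    then show ?thesis
      using r[of x] by (intro exI[of _ "x - r x"] exI[of _ "x + r x"]) auto
  qed
  then obtain C1 C2 where "C = C1 \<union> C2" "pairwise disjnt C1" "pairwise disjnt C2"
    using irredundant_intervals_two_colouring[OF _ C(2,3)] by metis
  then show ?thesis
    using C \<open>I ` S \<subseteq> F\<close> by (intro exI[of _ C1] exI[of _ C2]) auto
qed

end
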